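(* Let $C>0$ be a constant and let $(p_N)_{N\in\mathbb{N}}$ be a sequence of monic univariate polynomials with complex coefficients, $p_N$ of degree $N$, such that $\mu_{\rm norm}(p_N)\le C\sqrt{N}$ for all $N$. For each $N$ let $\omega_N=\{x_1,\dots,x_N\}\subset\mathbb{S}^2$ be the set of points with $\pi_{\mathbb{S}^2}(x_i)=z_i$, where $z_1,\dots,z_N$ are the roots of $p_N$. Then there is a constant $c$ depending only on $C$ such that for all $N$, $$\mathcal{E}_{\log}(\omega_N)\le \min_{\mu_N\subset\mathbb{S}^2}\mathcal{E}_{\log}(\mu_N)+cN,$$ where the minimum runs over all $N$-point subsets $\mu_N$ of $\mathbb{S}^2$.
   Context: $\mathbb{S}^2\subset\mathbb{R}^3$ is the unit sphere. $\pi_{\mathbb{S}^2}:\mathbb{S}^2\setminus\{(0,0,1)\}\to\mathbb{C}$ is the stereographic projection $(a,b,c)\mapsto \frac{a+ib}{1-c}$. For $\omega_N=\{x_1,\dots,x_N\}\subset\mathbb{S}^2$, $\mathcal{E}_{\log}(\omega_N)=-\sum_{i\neq j}\log\|x_i-x_j\|$. The Bombieri–Weyl norm of $P(z)=\sum_{i=0}^N a_iz^i$ (degree $N$) is $\|P\|=\big(\sum_{i=0}^N\binom{N}{i}^{-1}|a_i|^2\big)^{1/2}$. For a root $z$ of $P$, $\mu_{\rm norm}(P,z)=N^{1/2}\frac{\|P\|(1+|z|^2)^{N/2-1}}{|P'(z)|}$ (equal to $\infty$ if $z$ is a multiple root), and $\mu_{\rm norm}(P)=\max_{z:P(z)=0}\mu_{\rm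 norm}(P,z)$. *)

theory Defs
  imports "HOL-Analysis.Analysis" "HOL-Computational_Algebra.Polynomial" "HOL-Library.Extended_Real"
begin

definition sphere2 :: "(real^3) set" where
  "sphere2 = {x. norm x = 1}"

definition north_pole :: "real^3" where
  "north_pole = vector [0, 0, 1]"

definition stereo :: "real^3 \<Rightarrow> complex" where
  "stereo x = Complex (x$1) (x$2) / complex_of_real (1 - x$3)"

definition log_energy :: "(real^3) set \<Rightarrow> real" where
  "log_energy A = - (\<Sum>(x,y)\<in>{(x,y). x \<in> A \<and> y \<in> A \<and> x \<noteq> y}. ln (dist x y))"

text \<open>Bombieri-Weyl norm of P viewed as a polynomial of degree N.\<close>
definition bw_norm :: "nat \<Rightarrow> complex poly \<Rightarrow> real" where
  "bw_norm N P = sqrt (\<Sum>i\<le>N. (cmod (coeff P i))\<^sup>2 / real (N choose i))"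

definition mu_norm_at :: "nat \<Rightarrow> complex poly \<Rightarrow> complex \<Rightarrow> ereal" where
  "mu_norm_at N P z =
     (if poly (pderiv P) z = 0 then \<infinity>
      else ereal (sqrt (real N) * bw_norm N P * (1 + (cmod z)\<^sup>2) powr (real N / 2 - 1)
                  / cmod (poly (pderiv P) z)))"

definition mu_norm :: "nat \<Rightarrow> complex poly \<Rightarrow> ereal" where
  "mu_norm N P = (SUP z\<in>{z. poly P z = 0}. mu_norm_at N P z)"

definition root_points :: "complex poly \<Rightarrow> (real^3) set" where
  "root_points P = {x \<in> sphere2 - {north_pole}. poly P (stereo x) = 0}"

end

theory Submission
  imports Defs
    "HOL-Computational_Algebra.Fundamental_Theorem_Algebra"
    "HOL-Real_Asymp.Real_Asymp"
    "Jordan_Normal_Form.Determinant"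
begin

text \<open>
  Express the energy of a point set through the stereographic projections \<open>z\<^sub>i\<close> of its points. For the
  roots of \<open>p\<close>, the sum of \<open>ln \<bar>z\<^sub>i - z\<^sub>j\<bar>\<close> over \<open>j \<noteq> i\<close> is \<open>ln \<bar>p'(z\<^sub>i)\<bar>\<close>, which the condition number
  bounds from below in terms of \<open>\<parallel>p\<parallel>\<close>. The norm is in turn at least
  \<open>((N+1) e\<^sup>-\<^sup>N \<Prod>(1+\<bar>z\<^sub>i\<bar>\<^sup>2))\<^sup>1\<^sup>/\<^sup>2\<close>: it is an average of weighted coefficient norms, each of which dominates
  \<open>\<Prod> max t \<bar>z\<^sub>i\<bar>\<^sup>2\<close> by Landau's inequality, and Jensen's inequality turns the average of the product into
  the exponential of elementary integrals.

  For an arbitrary \<open>N\<close>-point set, Hadamard's inequality applied to the Vandermonde matrix, with its columns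
  scaled so that the rows are evaluation vectors for the Bombieri--Weyl norm, bounds the energy
  below by \<open>\<Sum>\<^sub>k ln (N-1 choose k) - N(N-1) ln 2\<close>. By Stirling's formula both bounds equal
  \<open>(1/2 - ln 2) N\<^sup>2 - (N/2) ln N\<close> up to \<open>O(N)\<close>.
\<close>

section \<open>Hadamard's inequality and the Vandermonde determinant\<close>

text \<open>Vectors are functions on \<open>nat\<close> of which only the values below
  \<open>n\<close> count, so a row of a matrix can be exchanged by a function update.\<close>

definition cip :: "nat \<Rightarrow> (nat \<Rightarrow> complex) \<Rightarrow> (nat \<Rightarrow> complex) \<Rightarrow> complex" where
  "cip n f g = (\<Sum>j<n. f j * cnj (g j))"

lemma cip_self: "cip n f f = of_real (\<Sum>j<n. (cmod (f j))\<^sup>2)"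
  by (simp add: cip_def complex_norm_square del: of_real_power)

lemma cip_commute: "cip n f g = cnj (cip n g f)"
  by (simp add: cip_def mult.commute)

lemma cip_diff_sum_left:
  "cip n (\<lambda>k. f k - (\<Sum>j\<in>J. c j * g j k)) h = cip n f h - (\<Sum>j\<in>J. c j * cip n (g j) h)"
proof -
  have "(\<Sum>k<n. (\<Sum>j\<in>J. c j * g j k) * cnj (h k)) = (\<Sum>j\<in>J. c j * (\<Sum>k<n. g j k * cnj (h k)))"
    by (simp add: sum_distrib_left sum_distrib_right mult.assoc sum.swap[of _ J])
  then show ?thesis
    by (simp add: cip_def left_diff_distrib sum_subtractf)
qed

lemma cip_eq_0_if_self_eq_0:
  assumes "cip n g g = 0"
  shows "cip n f g = 0"
proof -
  have "(\<Sum>j<n. (cmod (g j))\<^sup>2) = 0"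
    using assms unfolding cip_self of_real_eq_0_iff .
  then have "\<forall>j<n. g j = 0"
    by (subst (asm) sum_nonneg_eq_0_iff) auto
  then show ?thesis by (simp add: cip_def)
qed

lemma norm_le_pythagoras:
  assumes "cip n h s = 0"
  shows "(\<Sum>j<n. (cmod (h j))\<^sup>2) \<le> (\<Sum>j<n. (cmod (h j + s j))\<^sup>2)"
proof -
  have "(\<Sum>j<n. (cmod (h j + s j))\<^sup>2)
      = (\<Sum>j<n. (cmod (h j))\<^sup>2 + (cmod (s j))\<^sup>2 + 2 * Re (h j * cnj (s j)))"
    by (intro sum.cong) (auto simp: cmod_power2, simp add: power2_eq_square algebra_simps)
  also have "\<dots> = (\<Sum>j<n. (cmod (h j))\<^sup>2) + (\<Sum>j<n. (cmod (s j))\<^sup>2) + 2 * Re (cip n h s)"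
    by (simp add: cip_def sum.distrib sum_distrib_left)
  finally show ?thesis using assms by (simp add: sum_nonneg)
qed

text \<open>The row operation is left multiplication by \<open>L\<close>, a lower triangular matrix
  with ones on the diagonal.\<close>

lemma det_add_previous_rows:
  fixes g :: "nat \<Rightarrow> nat \<Rightarrow> complex"
  assumes "m < n"
  shows "Determinant.det (Matrix.mat n n (\<lambda>(i,k). (g(m := \<lambda>k. g m k - (\<Sum>j<m. c j * g j k))) i k))
       = Determinant.det (Matrix.mat n n (\<lambda>(i,k). g i k))" (is "Determinant.det ?G' = Determinant.det ?G")
proof -
  define L where
    "L = Matrix.mat n n (\<lambda>(i,j). if i = j then 1 else if i = m \<and> j < m then - c j else (0::complex))"
  have [simp]: "L \<in> carrier_mat n n" "?G \<in> carrier_mat n n" by (auto simp: L_def)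
  have "?G' = L * ?G"
  proof (rule eq_matI)
    fix i k assume "i < dim_row (L * ?G)" "k < dim_col (L * ?G)"
    then have i: "i < n" and k: "k < n" by (auto simp: L_def)
    have "(L * ?G) $$ (i,k) = (\<Sum>j = 0..<n. (if i = j then 1 else if i = m \<and> j < m then - c j else 0) * g j k)"
      using i k by (simp add: L_def scalar_prod_def)
    also have "\<dots> = (\<Sum>j = 0..<n. (if i = j then g j k else 0) + (if i = m \<and> j < m then - c j * g j k else 0))"
      by (intro sum.cong) auto
    also have "\<dots> = g i k + (\<Sum>j = 0..<n. if i = m \<and> j < m then - c j * g j k else 0)"
      using i by (simp add: sum.distrib)
    also have "(\<Sum>j = 0..<n. if i = m \<and> j < m then - c j * g j k else 0)
             = (if i = m then - (\<Sum>j<m. c j * g j k) else 0)"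
    proof -
      have "{0..<n} \<inter> {j. j < m} = {..<m}" using assms by auto
      then show ?thesis by (simp add: sum.If_cases flip: sum_negf)
    qed
    finally show "?G' $$ (i,k) = (L * ?G) $$ (i,k)" using i k by auto
  qed (auto simp: L_def)
  moreover have "Determinant.det L = 1"
    by (subst det_lower_triangular[of n]) (auto simp: L_def prod_list_diag_prod)
  ultimately show ?thesis by (simp add: Determinant.det_mult[of _ n])
qed

text \<open>Gram-Schmidt without normalization: one row at a time is replaced by its component
  orthogonal to the earlier rows. This is a row operation, so the determinant stays the same, and an
  orthogonal projection does not lengthen the row.\<close>

lemma orthogonalize_rows:
  fixes f :: "nat \<Rightarrow> nat \<Rightarrow> complex"
  assumes "m \<le> n"
  shows "\<exists>g. Determinant.det (Matrix.mat n n (\<lambda>(i,k). g i k)) = Determinant.det (Matrix.mat n n (\<lambda>(i,k). f i k))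
           \<and> (\<forall>i<m. \<forall>j<m. i \<noteq> j \<longrightarrow> cip n (g i) (g j) = 0)
           \<and> (\<forall>i. (\<Sum>k<n. (cmod (g i k))\<^sup>2) \<le> (\<Sum>k<n. (cmod (f i k))\<^sup>2))"
  using assms
proof (induction m)
  case 0
  then show ?case by auto
next
  case (Suc m)
  then obtain g where det_g: "Determinant.det (Matrix.mat n n (\<lambda>(i,k). g i k)) = Determinant.det (Matrix.mat n n (\<lambda>(i,k). f i k))"
    and orth: "\<And>i j. i < m \<Longrightarrow> j < m \<Longrightarrow> i \<noteq> j \<Longrightarrow> cip n (g i) (g j) = 0"
    and le: "\<And>i. (\<Sum>k<n. (cmod (g i k))\<^sup>2) \<le> (\<Sum>k<n. (cmod (f i k))\<^sup>2)"
    by auto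
  define c where "c j = cip n (g m) (g j) / cip n (g j) (g j)" for j
  define h where "h = (\<lambda>k. g m k - (\<Sum>j<m. c j * g j k))"
  have h_orth: "cip n h (g i) = 0" if "i < m" for i
  proof -
    have "(\<Sum>j<m. c j * cip n (g j) (g i)) = (\<Sum>j<m. if j = i then c i * cip n (g i) (g i) else 0)"
      using orth that by (intro sum.cong) auto
    also have "\<dots> = c i * cip n (g i) (g i)" using that by simp
    \<comment> \<open>If \<open>g i\<close> has norm zero, then \<open>c i\<close> is a division by
      zero, but both sides vanish.\<close>
    also have "\<dots> = cip n (g m) (g i)"
      using cip_eq_0_if_self_eq_0[of n "g i" "g m"] by (auto simp: c_def)
    finally show ?thesis unfolding h_def cip_diff_sum_left by simp
  qed
  have h_orth': "cip n (g i) h = 0" if "i < m" for i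
    using h_orth[OF that] cip_commute[of n "g i" h] by simp
  have "cip n h (\<lambda>k. \<Sum>j<m. c j * g j k) = 0"
  proof -
    \<comment> \<open>Written as zero minus a sum, the subtracted combination falls under
      \<open>cip_diff_sum_left\<close>.\<close>
    have "cip n (\<lambda>k. 0 - (\<Sum>j<m. c j * g j k)) h = 0"
      unfolding cip_diff_sum_left using h_orth' by (simp add: cip_def)
    then have "cip n (\<lambda>k. \<Sum>j<m. c j * g j k) h = 0"
      by (simp add: cip_def sum_negf)
    then show ?thesis using cip_commute[of n h] by simp
  qed
  from norm_le_pythagoras[OF this] have h_le: "(\<Sum>k<n. (cmod (h k))\<^sup>2) \<le> (\<Sum>k<n. (cmod (g m k))\<^sup>2)"
    by (simp add: h_def)
  have "Determinant.det (Matrix.mat n n (\<lambda>(i,k). (g(m := h)) i k)) = Determinant.det (Matrix.mat n n (\<lambda>(i,k). f i k))"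
    using det_add_previous_rows[of m n g c] det_g Suc.prems unfolding h_def by simp
  moreover have "\<forall>i<Suc m. \<forall>j<Suc m. i \<noteq> j \<longrightarrow> cip n ((g(m := h)) i) ((g(m := h)) j) = 0"
    using orth h_orth h_orth' by (auto simp: less_Suc_eq)
  moreover have "\<forall>i. (\<Sum>k<n. (cmod ((g(m := h)) i k))\<^sup>2) \<le> (\<Sum>k<n. (cmod (f i k))\<^sup>2)"
    using le h_le order_trans by fastforce
  ultimately show ?case by blast
qed

text \<open>For orthogonal rows the product of \<open>G\<close> with its conjugate transpose is
  diagonal and carries the squared row norms, so equality holds. Orthogonalization keeps the left
  side and can only decrease the right side.\<close>

lemma hadamard_inequality:
  fixes f :: "nat \<Rightarrow> nat \<Rightarrow> complex"
  shows "(cmod (Determinant.det (Matrix.mat n n (\<lambda>(i,k). f i k))))\<^sup>2 \<le> (\<Prod>i<n. \<Sum>k<n. (cmod (f i k))\<^sup>2)"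
proof -
  obtain g where det_g: "Determinant.det (Matrix.mat n n (\<lambda>(i,k). g i k)) = Determinant.det (Matrix.mat n n (\<lambda>(i,k). f i k))"
    and orth: "\<And>i j. i < n \<Longrightarrow> j < n \<Longrightarrow> i \<noteq> j \<Longrightarrow> cip n (g i) (g j) = 0"
    and le: "\<And>i. (\<Sum>k<n. (cmod (g i k))\<^sup>2) \<le> (\<Sum>k<n. (cmod (f i k))\<^sup>2)"
    using orthogonalize_rows[of n n f] by auto
  define G where "G = Matrix.mat n n (\<lambda>(i,k). g i k)"
  define H where "H = transpose_mat (map_mat cnj G)"
  have G [simp]: "G \<in> carrier_mat n n" and H [simp]: "H \<in> carrier_mat n n"
    and cG: "map_mat cnj G \<in> carrier_mat n n" by (auto simp: G_def H_def)
  interpret cnj: comm_ring_hom cnj by unfold_locales auto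
  have "Determinant.det H = cnj (Determinant.det G)"
    unfolding H_def by (subst Determinant.det_transpose[OF cG]) (rule cnj.hom_det)
  then have "of_real ((cmod (Determinant.det G))\<^sup>2) = Determinant.det (G * H)"
    by (simp add: Determinant.det_mult[of _ n] complex_norm_square del: of_real_power)
  also have entry: "(G * H) $$ (i,j) = cip n (g i) (g j)" if "i < n" "j < n" for i j
    using that by (simp add: G_def H_def scalar_prod_def cip_def atLeast0LessThan)
  have "Determinant.det (G * H) = (\<Prod>i<n. (G * H) $$ (i,i))"
  proof (subst det_lower_triangular[of n])
    show "prod_list (diag_mat (G * H)) = (\<Prod>i<n. (G * H) $$ (i,i))"
      using H by (simp add: prod_list_diag_prod atLeast0LessThan G_def)
  qed (use entry orth mult_carrier_mat[OF G H] in auto)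
  also have "\<dots> = (\<Prod>i<n. of_real (\<Sum>k<n. (cmod (g i k))\<^sup>2))"
    by (intro prod.cong) (auto simp: entry simp del: of_real_sum simp flip: cip_self)
  also have "\<dots> = of_real (\<Prod>i<n. \<Sum>k<n. (cmod (g i k))\<^sup>2)" by simp
  finally have "(cmod (Determinant.det G))\<^sup>2 = (\<Prod>i<n. \<Sum>k<n. (cmod (g i k))\<^sup>2)"
    unfolding of_real_eq_iff .
  also have "\<dots> \<le> (\<Prod>i<n. \<Sum>k<n. (cmod (f i k))\<^sup>2)"
    by (intro prod_mono conjI le sum_nonneg) auto
  finally show ?thesis using det_g by (simp add: G_def)
qed

section \<open>Vandermonde determinants\<close>

text \<open>Pass from monomials to the Newton basis \<open>q k\<close>. Since \<open>q k\<close> is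
  monic of degree \<open>k\<close>, the change of basis \<open>T\<close> is upper triangular with
  unit diagonal; since \<open>q k\<close> vanishes at \<open>z i\<close> for \<open>i < k\<close>,
  the product \<open>V * T\<close> is lower triangular.\<close>

lemma det_vandermonde:
  fixes z :: "nat \<Rightarrow> complex"
  shows "Determinant.det (Matrix.mat n n (\<lambda>(i,k). z i ^ k)) = (\<Prod>i<n. \<Prod>j<i. z i - z j)"
proof -
  define q where "q k = (\<Prod>j<k. [:- z j, 1:])" for k
  have deg_q: "degree (q k) = k" for k
    unfolding q_def by (subst degree_prod_sum_eq) auto
  have lead_q: "coeff (q k) k = 1" for k
  proof -
    have "lead_coeff (q k) = 1" unfolding q_def by (subst lead_coeff_prod) auto
    then show ?thesis by (simp add: deg_q)
  qed
  define V where "V = Matrix.mat n n (\<lambda>(i,k). z i ^ k)"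
  define T where "T = Matrix.mat n n (\<lambda>(i,k). coeff (q k) i)"
  have carr [simp]: "V \<in> carrier_mat n n" "T \<in> carrier_mat n n" by (auto simp: V_def T_def)
  have VT: "(V * T) $$ (i,k) = (\<Prod>j<k. z i - z j)" if "i < n" "k < n" for i k
  proof -
    have "(V * T) $$ (i,k) = (\<Sum>m<n. coeff (q k) m * z i ^ m)"
      using that by (simp add: V_def T_def scalar_prod_def atLeast0LessThan mult.commute)
    also have "\<dots> = (\<Sum>m\<le>degree (q k). coeff (q k) m * z i ^ m)"
      using that by (intro sum.mono_neutral_right) (auto simp: deg_q coeff_eq_0)
    also have "\<dots> = poly (q k) (z i)" by (simp add: poly_altdef)
    also have "\<dots> = (\<Prod>j<k. z i - z j)" by (simp add: q_def poly_prod)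
    finally show ?thesis .
  qed
  have "Determinant.det T = 1"
  proof (subst det_upper_triangular[of _ n])
    show "upper_triangular T"
      by (auto simp: T_def upper_triangular_def coeff_eq_0 deg_q)
    show "prod_list (diag_mat T) = 1"
      by (simp add: T_def prod_list_diag_prod lead_q)
  qed simp
  then have "Determinant.det V = Determinant.det (V * T)"
    by (simp add: Determinant.det_mult[of _ n])
  also have "\<dots> = (\<Prod>i<n. (V * T) $$ (i,i))"
  proof (subst det_lower_triangular[of n])
    show "prod_list (diag_mat (V * T)) = (\<Prod>i<n. (V * T) $$ (i,i))"
      by (simp add: prod_list_diag_prod atLeast0LessThan V_def)
    show "(V * T) $$ (i,j) = 0" if "i < j" "j < n" for i j
      using that by (subst VT) auto
    show "V * T \<in> carrier_mat n n" by (rule mult_carrier_mat[of _ n n _ n]) simp_all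
  qed
  also have "\<dots> = (\<Prod>i<n. \<Prod>j<i. z i - z j)" by (simp add: VT)
  finally show ?thesis by (simp add: V_def)
qed

text \<open>There are \<open>Suc n\<close> nodes, so the weights \<open>n choose k\<close> fill one
  row of Pascal's triangle, and the binomial theorem evaluates the squared norm of each row
  \<open>f i\<close>. The column scaling contributes the determinant of the diagonal matrix
  \<open>D\<close>.\<close>

lemma vandermonde_bound:
  fixes z :: "nat \<Rightarrow> complex"
  shows "(\<Prod>k<Suc n. real (n choose k)) * (\<Prod>i<Suc n. \<Prod>j<i. cmod (z i - z j))\<^sup>2
         \<le> (\<Prod>i<Suc n. (1 + (cmod (z i))\<^sup>2) ^ n)"
proof -
  define f where "f i k = of_real (sqrt (real (n choose k))) * z i ^ k" for i k
  define V where "V = Matrix.mat (Suc n) (Suc n) (\<lambda>(i,k). z i ^ k)"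
  define D where "D = Matrix.mat (Suc n) (Suc n)
    (\<lambda>(i,k). if i = k then complex_of_real (sqrt (real (n choose k))) else 0)"
  have carr [simp]: "V \<in> carrier_mat (Suc n) (Suc n)" "D \<in> carrier_mat (Suc n) (Suc n)"
    by (auto simp: V_def D_def)
  have "Matrix.mat (Suc n) (Suc n) (\<lambda>(i,k). f i k) = V * D"
  proof (rule eq_matI)
    fix i k assume "i < dim_row (V * D)" "k < dim_col (V * D)"
    then have ik: "i < Suc n" "k < Suc n" by (auto simp: V_def D_def)
    have "(V * D) $$ (i,k) = (\<Sum>j = 0..<Suc n. if j = k then z i ^ k * of_real (sqrt (real (n choose k))) else 0)"
      using ik unfolding V_def D_def
      by (simp add: scalar_prod_def if_distrib[of "(*) _"] cong: if_cong del: sum.op_ivl_Suc)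
    then show "Matrix.mat (Suc n) (Suc n) (\<lambda>(i,k). f i k) $$ (i,k) = (V * D) $$ (i,k)"
      using ik by (simp add: f_def del: sum.op_ivl_Suc)
  qed (auto simp: V_def D_def)
  moreover have sqrt_prod: "(\<Prod>k<Suc n. sqrt (real (n choose k)))\<^sup>2 = (\<Prod>k<Suc n. real (n choose k))"
    by (simp add: prod_power_distrib del: prod.lessThan_Suc)
  ultimately have "Determinant.det (Matrix.mat (Suc n) (Suc n) (\<lambda>(i,k). f i k))
      = Determinant.det V * Determinant.det D"
    by (simp add: Determinant.det_mult[of _ "Suc n"])
  also have "Determinant.det D = (\<Prod>k<Suc n. of_real (sqrt (real (n choose k))))"
    by (subst det_lower_triangular[of "Suc n"])
       (auto simp: D_def prod_list_diag_prod atLeast0LessThan simp del: prod.lessThan_Suc prod.op_ivl_Suc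
             intro!: prod.cong)
  also have "Determinant.det V = (\<Prod>i<Suc n. \<Prod>j<i. z i - z j)"
    unfolding V_def by (rule det_vandermonde)
  finally have "(cmod (Determinant.det (Matrix.mat (Suc n) (Suc n) (\<lambda>(i,k). f i k))))\<^sup>2
      = (\<Prod>k<Suc n. real (n choose k)) * (\<Prod>i<Suc n. \<Prod>j<i. cmod (z i - z j))\<^sup>2"
    by (simp add: norm_mult power_mult_distrib sqrt_prod flip: prod_norm del: prod.lessThan_Suc)
  moreover have "(\<Sum>k<Suc n. (cmod (f i k))\<^sup>2) = (1 + (cmod (z i))\<^sup>2) ^ n" for i
  proof -
    have "((cmod (z i))\<^sup>2 + 1) ^ n = (\<Sum>k\<le>n. real (n choose k) * ((cmod (z i))\<^sup>2) ^ k * 1 ^ (n - k))"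
      by (rule binomial_ring)
    also have "\<dots> = (\<Sum>k<Suc n. (cmod (f i k))\<^sup>2)"
      unfolding lessThan_Suc_atMost f_def
      by (intro sum.cong) (auto simp: norm_mult norm_power power_mult_distrib power_even_eq simp flip: power_mult)
    finally show ?thesis by (simp add: add.commute)
  qed
  ultimately show ?thesis using hadamard_inequality[of "Suc n" f] by simp
qed

section \<open>A lower bound for the Bombieri--Weyl norm\<close>

text \<open>By Parseval this is the mean of \<open>|p|^2\<close> over the circle of radius
  \<open>sqrt t\<close>, for \<open>t > 0\<close> and \<open>degree p\<close> at most
  \<open>n\<close>.\<close>

definition weighted_norm :: "real \<Rightarrow> nat \<Rightarrow> complex poly \<Rightarrow> real" where
  "weighted_norm t n p = (\<Sum>i\<le>n. (cmod (coeff p i))\<^sup>2 * t ^ i)"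

text \<open>The right side depends on \<open>a\<close> and \<open>b\<close> only through
  \<open>(cmod a)^2 + t * (cmod b)^2\<close> and \<open>a * cnj b\<close>. Linear factors that agree
  in these two quantities are therefore interchangeable.\<close>

lemma weighted_norm_linear_mult:
  assumes "degree q \<le> n"
  shows "weighted_norm t (Suc n) ([:a, b:] * q)
       = ((cmod a)\<^sup>2 + t * (cmod b)\<^sup>2) * weighted_norm t n q
         + 2 * Re (a * cnj b * (\<Sum>i\<le>n. of_real (t ^ Suc i) * coeff q (Suc i) * cnj (coeff q i)))"
proof -
  have top: "coeff q (Suc n) = 0" using assms by (simp add: coeff_eq_0)
  have "weighted_norm t (Suc n) ([:a, b:] * q)
      = (cmod (a * coeff q 0))\<^sup>2 + (\<Sum>i\<le>n. (cmod (a * coeff q (Suc i) + b * coeff q i))\<^sup>2 * t ^ Suc i)"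
    unfolding weighted_norm_def by (subst sum.atMost_Suc_shift) simp
  also have "(\<Sum>i\<le>n. (cmod (a * coeff q (Suc i) + b * coeff q i))\<^sup>2 * t ^ Suc i)
      = (\<Sum>i\<le>n. (cmod a)\<^sup>2 * ((cmod (coeff q (Suc i)))\<^sup>2 * t ^ Suc i)
                + t * (cmod b)\<^sup>2 * ((cmod (coeff q i))\<^sup>2 * t ^ i)
                + 2 * Re (a * cnj b * (of_real (t ^ Suc i) * coeff q (Suc i) * cnj (coeff q i))))"
  proof (intro sum.cong refl)
    fix i
    have *: "(cmod (u + v))\<^sup>2 = (cmod u)\<^sup>2 + (cmod v)\<^sup>2 + 2 * Re (u * cnj v)" for u v :: complex
      by (simp add: cmod_power2) (simp add: power2_eq_square algebra_simps)
    have "Re (a * cnj b * (of_real (t ^ Suc i) * coeff q (Suc i) * cnj (coeff q i)))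
        = Re (of_real (t ^ Suc i) * ((a * coeff q (Suc i)) * cnj (b * coeff q i)))"
      by (simp only: complex_cnj_mult mult_ac)
    also have "\<dots> = t ^ Suc i * Re ((a * coeff q (Suc i)) * cnj (b * coeff q i))"
      by (simp only: Re_complex_of_real Im_complex_of_real times_complex.sel)
    finally have cross: "Re (a * cnj b * (of_real (t ^ Suc i) * coeff q (Suc i) * cnj (coeff q i)))
        = t ^ Suc i * Re ((a * coeff q (Suc i)) * cnj (b * coeff q i))" .
    show "(cmod (a * coeff q (Suc i) + b * coeff q i))\<^sup>2 * t ^ Suc i
        = (cmod a)\<^sup>2 * ((cmod (coeff q (Suc i)))\<^sup>2 * t ^ Suc i)
                + t * (cmod b)\<^sup>2 * ((cmod (coeff q i))\<^sup>2 * t ^ i)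
                + 2 * Re (a * cnj b * (of_real (t ^ Suc i) * coeff q (Suc i) * cnj (coeff q i)))"
      unfolding * cross norm_mult power_mult_distrib by (simp only: distrib_left distrib_right power_Suc mult_ac)
  qed
  also have "\<dots> = (cmod a)\<^sup>2 * (\<Sum>i\<le>n. (cmod (coeff q (Suc i)))\<^sup>2 * t ^ Suc i)
      + t * (cmod b)\<^sup>2 * weighted_norm t n q
      + 2 * Re (a * cnj b * (\<Sum>i\<le>n. of_real (t ^ Suc i) * coeff q (Suc i) * cnj (coeff q i)))"
    unfolding weighted_norm_def by (simp only: sum.distrib sum_distrib_left Re_sum)
  \<comment> \<open>The shifted sum lacks the constant coefficient of \<open>q\<close>; the separate
    term \<open>(cmod (a * coeff q 0))^2\<close> restores it.\<close>
  also have "(\<Sum>i\<le>n. (cmod (coeff q (Suc i)))\<^sup>2 * t ^ Suc i) = weighted_norm t n q - (cmod (coeff q 0))\<^sup>2"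
  proof -
    have "weighted_norm t n q = weighted_norm t (Suc n) q"
      by (simp add: weighted_norm_def top)
    also have "\<dots> = (cmod (coeff q 0))\<^sup>2 + (\<Sum>i\<le>n. (cmod (coeff q (Suc i)))\<^sup>2 * t ^ Suc i)"
      unfolding weighted_norm_def by (subst sum.atMost_Suc_shift) simp
    finally show ?thesis by simp
  qed
  finally show ?thesis by (simp add: norm_mult power_mult_distrib algebra_simps)
qed

text \<open>A root outside the circle of radius \<open>sqrt t\<close> moves to its mirror image
  \<open>t / cnj z\<close> inside, and the leading coefficient gets modulus
  \<open>cmod z / sqrt t\<close>.\<close>

definition reflect_factor :: "real \<Rightarrow> complex \<Rightarrow> complex poly" where
  "reflect_factor t z = (if (cmod z)\<^sup>2 \<le> t then [:- z, 1:] else [:of_real (sqrt t), - cnj z / of_real (sqrt t):])"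

text \<open>
  On the circle \<open>\<bar>x\<bar> = \<surd>t\<close> both factors have the same modulus, so reflecting a root in this circle
  preserves the weighted coefficient norm while moving all of the size into the leading coefficient.
\<close>

lemma weighted_norm_reflect:
  assumes "t > 0" "degree q \<le> n"
  shows "weighted_norm t (Suc n) ([:- z, 1:] * q) = weighted_norm t (Suc n) (reflect_factor t z * q)"
proof -
  define r where "r = sqrt t"
  have r: "r > 0" "r\<^sup>2 = t" using assms by (auto simp: r_def)
  \<comment> \<open>The two factors agree in both quantities that enter
    \<open>weighted_norm_linear_mult\<close>.\<close>
  have "(cmod (- z))\<^sup>2 + t * (cmod 1)\<^sup>2 = (cmod (of_real r))\<^sup>2 + t * (cmod (- cnj z / of_real r))\<^sup>2"
    using r assms by (simp add: norm_divide power_divide)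
  moreover have "- z * cnj 1 = of_real r * cnj (- cnj z / of_real r)"
    using r by simp
  ultimately have "weighted_norm t (Suc n) ([:- z, 1:] * q)
      = weighted_norm t (Suc n) ([:of_real r, - cnj z / of_real r:] * q)"
    unfolding weighted_norm_linear_mult[OF assms(2)] by (simp only:)
  then show ?thesis by (simp only: reflect_factor_def r_def split: if_split) simp
qed

text \<open>The cofactor \<open>q\<close> is arbitrary because it collects the factors already
  reflected during the induction.\<close>

lemma weighted_norm_reflect_prod:
  assumes "t > 0" "finite Z"
  shows "degree q + card Z \<le> n \<Longrightarrow>
    weighted_norm t n ((\<Prod>z\<in>Z. [:- z, 1:]) * q) = weighted_norm t n ((\<Prod>z\<in>Z. reflect_factor t z) * q)"
  using assms(2)
proof (induction Z arbitrary: q)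
  case empty
  then show ?case by simp
next
  case (insert z Z)
  then obtain m where m: "n = Suc m" by (cases n) auto
  have deg: "degree (reflect_factor t z) \<le> 1" "degree [:- z, 1:] \<le> 1"
    by (auto simp: reflect_factor_def)
  have degP: "degree (\<Prod>z\<in>Z. [:- z, 1:]) \<le> card Z"
    using degree_prod_sum_le[OF insert.hyps(1), of "\<lambda>z. [:- z, 1:]"] by simp
  have "weighted_norm t n ((\<Prod>z\<in>insert z Z. [:- z, 1:]) * q)
      = weighted_norm t n ([:- z, 1:] * ((\<Prod>z\<in>Z. [:- z, 1:]) * q))"
    by (simp only: prod.insert[OF insert.hyps] mult.assoc)
  also have "\<dots> = weighted_norm t n (reflect_factor t z * ((\<Prod>z\<in>Z. [:- z, 1:]) * q))"
    unfolding m
  proof (rule weighted_norm_reflect[OF assms(1)])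
    show "degree ((\<Prod>z\<in>Z. [:- z, 1:]) * q) \<le> m"
      using degP degree_mult_le[of "\<Prod>z\<in>Z. [:- z, 1:]" q] insert.prems insert.hyps m by simp
  qed
  also have "\<dots> = weighted_norm t n ((\<Prod>z\<in>Z. [:- z, 1:]) * (reflect_factor t z * q))"
    by (simp only: mult_ac)
  also have "\<dots> = weighted_norm t n ((\<Prod>z\<in>Z. reflect_factor t z) * (reflect_factor t z * q))"
    using insert.prems insert.hyps deg degree_mult_le[of "reflect_factor t z" q]
    by (intro insert.IH) auto
  finally show ?case by (simp only: prod.insert[OF insert.hyps] mult_ac)
qed

text \<open>After reflection only the top term of the weighted norm is kept. It is multiplicative:
  each root contributes the squared modulus of its leading coefficient times \<open>t\<close>, which
  is \<open>t\<close> or \<open>(cmod z)^2\<close> according to the side of the circle.\<close>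

lemma weighted_norm_ge_prod_max:
  assumes "t > 0" "finite Z"
  shows "(\<Prod>z\<in>Z. max t ((cmod z)\<^sup>2)) \<le> weighted_norm t (card Z) (\<Prod>z\<in>Z. [:- z, 1:])"
proof -
  define Q where "Q = (\<Prod>z\<in>Z. reflect_factor t z)"
  have rt: "sqrt t > 0" using assms by simp
  have deg1: "degree (reflect_factor t z) = 1" for z
    using assms by (auto simp: reflect_factor_def)
  have nonzero: "reflect_factor t z \<noteq> 0" for z
    using deg1[of z] by auto
  have "degree Q = card Z"
    unfolding Q_def by (subst degree_prod_sum_eq) (auto simp: deg1 nonzero)
  then have "coeff Q (card Z) = (\<Prod>z\<in>Z. lead_coeff (reflect_factor t z))"
    using lead_coeff_prod[of "reflect_factor t" Z] by (simp add: Q_def)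
  then have "(cmod (coeff Q (card Z)))\<^sup>2 * t ^ card Z = (\<Prod>z\<in>Z. (cmod (lead_coeff (reflect_factor t z)))\<^sup>2 * t)"
    by (simp add: prod.distrib prod_power_distrib flip: prod_norm)
  also have "\<dots> = (\<Prod>z\<in>Z. max t ((cmod z)\<^sup>2))"
  proof (intro prod.cong refl)
    fix z
    show "(cmod (lead_coeff (reflect_factor t z)))\<^sup>2 * t = max t ((cmod z)\<^sup>2)"
      using assms by (auto simp: deg1, auto simp: reflect_factor_def norm_divide power_divide max_def)
  qed
  finally have "(\<Prod>z\<in>Z. max t ((cmod z)\<^sup>2)) = (cmod (coeff Q (card Z)))\<^sup>2 * t ^ card Z" ..
  also have "\<dots> \<le> weighted_norm t (card Z) Q"
    unfolding weighted_norm_def using assms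
    by (intro member_le_sum[where f = "\<lambda>i. (cmod (coeff Q i))\<^sup>2 * t ^ i"]) auto
  also have "\<dots> = weighted_norm t (card Z) (\<Prod>z\<in>Z. [:- z, 1:])"
    using weighted_norm_reflect_prod[OF assms, of 1 "card Z"] by (simp add: Q_def)
  finally show ?thesis .
qed

section \<open>Averaging the weighted norms into the Bombieri-Weyl norm\<close>

text \<open>A Beta integral; it produces the inverse binomial weights of
  \<open>bw_norm\<close>.\<close>

lemma has_integral_bernstein:
  assumes "i \<le> n"
  shows "((\<lambda>u. u ^ i * (1 - u) ^ (n - i)) has_integral 1 / (real (n + 1) * real (n choose i))) {0<..<1::real}"
proof -
  have "((\<lambda>u. u powr (real (Suc i) - 1) * (1 - u) powr (real (Suc (n - i)) - 1)) has_integral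
          Beta (real (Suc i)) (real (Suc (n - i)))) {0<..<1}"
    using has_integral_Beta_real[of "real (Suc i)" "real (Suc (n - i))"]
    unfolding has_integral_Icc_iff_Ioo by simp
  then have "((\<lambda>u. u ^ i * (1 - u) ^ (n - i)) has_integral Beta (real (Suc i)) (real (Suc (n - i)))) {0<..<1::real}"
    by (rule has_integral_eq[rotated]) (simp add: powr_realpow)
  also have "Beta (real (Suc i)) (real (Suc (n - i))) = fact i * fact (n - i) / fact (n + 1)"
    using assms Gamma_fact[of i, where 'a = real] Gamma_fact[of "n - i", where 'a = real]
      Gamma_fact[of "n + 1", where 'a = real]
    by (simp add: Beta_def of_nat_diff add_ac)
  also have "\<dots> = 1 / (real (n + 1) * real (n choose i))"
    using assms by (simp add: binomial_fact field_simps)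
  finally show ?thesis .
qed

text \<open>At 0 the function takes its limit value 0. This endpoint occurs in the following
  integral when \<open>a = 0\<close>.\<close>

lemma continuous_on_x_ln_x: "continuous_on {0..} (\<lambda>x::real. x * ln x)"
proof -
  have "continuous (at x within {0..}) (\<lambda>x::real. x * ln x)" if "x \<ge> 0" for x
  proof (cases "x = 0")
    case True
    have "((\<lambda>x::real. x * ln x) \<longlongrightarrow> 0) (at_right 0)" by real_asymp
    moreover have "at (0::real) within {0..} = at_right 0"
      by (metis at_within_Icc_at_right at_within_Ici_at_right)
    ultimately show ?thesis using True by (simp add: continuous_within)
  next
    case False
    then show ?thesis using that by (intro continuous_intros) auto
  qed
  then show ?thesis by (auto simp: continuous_on_eq_continuous_within)
qed

lemma has_integral_ln_max:
  fixes a :: real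
  assumes "a \<ge> 0"
  shows "((\<lambda>u. ln (max u ((1 - u) * a))) has_integral (ln (1 + a) - 1)) {0<..<1}"
proof -
  \<comment> \<open>The two arguments of \<open>max\<close> agree at \<open>s\<close>; to the left
    \<open>(1 - u) * a\<close> is larger, to the right \<open>u\<close> is.\<close>
  define s where "s = a / (1 + a)"
  have s: "0 \<le> s" "s < 1" "1 - s = 1 / (1 + a)" "s = (1 - s) * a"
    using assms by (auto simp: s_def field_simps)
  have "((\<lambda>u. ln (max u ((1 - u) * a))) has_integral
      ((s * ln a - ((1 - s) * ln (1 - s)) + (1 - s)) - (0 * ln a - ((1 - 0) * ln (1 - 0)) + (1 - 0)))) {0..s}"
  proof (rule fundamental_theorem_of_calculus_interior)
    show "continuous_on {0..s} (\<lambda>u. u * ln a - ((1 - u) * ln (1 - u)) + (1 - u))"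
      using s by (intro continuous_intros) auto
    fix u assume u: "u \<in> {0<..<s}"
    \<comment> \<open>For \<open>a = 0\<close> also \<open>s = 0\<close>, and the interval is
      empty.\<close>
    then have "a > 0" using s by (cases "a = 0") (use assms in \<open>auto simp: s_def\<close>)
    have "u * (1 + a) < a" using u assms by (simp add: s_def field_simps)
    then have "max u ((1 - u) * a) = (1 - u) * a" by (simp add: max_def algebra_simps)
    then have "ln (max u ((1 - u) * a)) = ln (1 - u) + ln a"
      using u s(2) \<open>a > 0\<close> by (simp add: ln_mult del: greaterThanLessThan_iff, auto simp: ln_mult)
    moreover have "((\<lambda>u. u * ln a - ((1 - u) * ln (1 - u)) + (1 - u)) has_real_derivative (ln (1 - u) + ln a)) (at u)"
      using u s by (auto intro!: derivative_eq_intros)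
    ultimately show "((\<lambda>u. u * ln a - ((1 - u) * ln (1 - u)) + (1 - u)) has_vector_derivative
        ln (max u ((1 - u) * a))) (at u)"
      by (simp add: has_real_derivative_iff_has_vector_derivative)
  qed (use s in auto)
  moreover have "((\<lambda>u. ln (max u ((1 - u) * a))) has_integral ((1 * ln 1 - 1) - (s * ln s - s))) {s..1}"
  proof (rule fundamental_theorem_of_calculus_interior)
    show "continuous_on {s..1} (\<lambda>u. u * ln u - u)"
      using s by (intro continuous_intros continuous_on_subset[OF continuous_on_x_ln_x]) auto
    fix u assume u: "u \<in> {s<..<1}"
    then have "a < u * (1 + a)" using assms by (simp add: s_def field_simps)
    then have "max u ((1 - u) * a) = u" by (simp add: max_def algebra_simps)
    moreover have "((\<lambda>u. u * ln u - u) has_real_derivative ln u) (at u)"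
      using u s by (auto intro!: derivative_eq_intros)
    ultimately show "((\<lambda>u. u * ln u - u) has_vector_derivative ln (max u ((1 - u) * a))) (at u)"
      by (simp add: has_real_derivative_iff_has_vector_derivative)
  qed (use s in auto)
  ultimately have "((\<lambda>u. ln (max u ((1 - u) * a))) has_integral
      ((s * ln a - ((1 - s) * ln (1 - s)) + (1 - s)) - (0 * ln a - ((1 - 0) * ln (1 - 0)) + (1 - 0))
       + ((1 * ln 1 - 1) - (s * ln s - s)))) {0..1}"
    by (rule has_integral_combine[rotated 2]) (use s in auto)
  \<comment> \<open>Multiplied by \<open>s\<close>, the identity holds for \<open>a = 0\<close> as
    well.\<close>
  moreover have "s * ln s = s * (ln (1 - s) + ln a)"
  proof (cases "a = 0")
    case False
    then have "ln s = ln (1 - s) + ln a"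
      using assms unfolding s_def s(3)[unfolded s_def] by (simp add: ln_div)
    then show ?thesis by simp
  qed (simp add: s_def)
  moreover have "ln (1 - s) = - ln (1 + a)"
    using assms unfolding s(3) by (simp add: ln_div)
  ultimately show ?thesis
    unfolding has_integral_Icc_iff_Ioo by (simp add: algebra_simps)
qed

text \<open>The average is over \<open>u\<close> uniform in the unit interval, with weight
  \<open>t = u / (1 - u)\<close>. Then \<open>F u\<close> is \<open>(1 - u) ^ n\<close> times the
  weighted norm and integrates to the squared Bombieri-Weyl norm over \<open>n + 1\<close>, while
  \<open>J z\<close> is the integral of \<open>ln (m u z)\<close>.\<close>

lemma bw_norm_ge:
  assumes "finite Z"
  defines "n \<equiv> card Z"
  shows "exp ((\<Sum>z\<in>Z. ln (1 + (cmod z)\<^sup>2)) - real n) * real (n + 1)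
         \<le> (bw_norm n (\<Prod>z\<in>Z. [:- z, 1:]))\<^sup>2"
proof -
  define P where "P = (\<Prod>z\<in>Z. [:- z, 1:])"
  define G where "G = exp ((\<Sum>z\<in>Z. ln (1 + (cmod z)\<^sup>2)) - real n)"
  define J where "J z = ln (1 + (cmod z)\<^sup>2) - 1" for z
  define m where "m u z = max u ((1 - u) * (cmod z)\<^sup>2)" for u :: real and z
  define F where "F u = (\<Sum>i\<le>n. (cmod (coeff P i))\<^sup>2 * (u ^ i * (1 - u) ^ (n - i)))" for u :: real
  have G_J: "G = exp (\<Sum>z\<in>Z. J z)" by (simp add: G_def J_def n_def sum_subtractf)
  have lower: "G * (1 + (\<Sum>z\<in>Z. ln (m u z) - J z)) \<le> F u" if u: "u \<in> {0<..<1}" for u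
  proof -
    define t where "t = u / (1 - u)"
    have t: "t > 0" using u by (simp add: t_def)
    have m_pos: "m u z > 0" for z using u by (simp add: m_def less_max_iff_disj)
    \<comment> \<open>Jensen's inequality for \<open>exp\<close>, in tangent line form\<close>
    have "G * (1 + (\<Sum>z\<in>Z. ln (m u z) - J z)) \<le> G * exp (\<Sum>z\<in>Z. ln (m u z) - J z)"
      by (intro mult_left_mono exp_ge_add_one_self) (simp add: G_def)
    also have "\<dots> = exp (\<Sum>z\<in>Z. ln (m u z))"
      by (simp add: G_J sum_subtractf flip: exp_add)
    also have "\<dots> = (\<Prod>z\<in>Z. m u z)"
      using assms m_pos by (simp add: exp_sum)
    also have "\<dots> = (\<Prod>z\<in>Z. (1 - u) * max t ((cmod z)\<^sup>2))"
      using u by (intro prod.cong) (auto simp: m_def t_def max_mult_distrib_left)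
    also have "\<dots> = (1 - u) ^ n * (\<Prod>z\<in>Z. max t ((cmod z)\<^sup>2))"
      by (simp add: prod.distrib n_def)
    also have "\<dots> \<le> (1 - u) ^ n * weighted_norm t n P"
      unfolding P_def n_def using u t assms by (intro mult_left_mono weighted_norm_ge_prod_max) auto
    also have "\<dots> = F u"
      unfolding weighted_norm_def F_def sum_distrib_left
    proof (intro sum.cong refl)
      fix i assume "i \<in> {..n}"
      then have "(1 - u) ^ n = (1 - u) ^ i * (1 - u) ^ (n - i)" by (simp flip: power_add)
      then show "(1 - u) ^ n * ((cmod (coeff P i))\<^sup>2 * t ^ i) = (cmod (coeff P i))\<^sup>2 * (u ^ i * (1 - u) ^ (n - i))"
        using u by (simp add: t_def power_divide)
    qed
    finally show ?thesis .
  qed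
  have "(F has_integral (\<Sum>i\<le>n. (cmod (coeff P i))\<^sup>2 * (1 / (real (n + 1) * real (n choose i))))) {0<..<1}"
    unfolding F_def by (intro has_integral_sum has_integral_mult_right has_integral_bernstein) auto
  also have "(\<Sum>i\<le>n. (cmod (coeff P i))\<^sup>2 * (1 / (real (n + 1) * real (n choose i)))) = (bw_norm n P)\<^sup>2 / real (n + 1)"
    by (simp add: bw_norm_def sum_nonneg sum_divide_distrib mult.commute)
  finally have F_int: "(F has_integral (bw_norm n P)\<^sup>2 / real (n + 1)) {0<..<1}" .
  have one: "((\<lambda>u::real. c) has_integral c) {0<..<1}" for c :: real
    unfolding has_integral_Icc_iff_Ioo[symmetric] using has_integral_const_real[of c 0 1] by simp
  \<comment> \<open>The deviations \<open>ln (m u z) - J z\<close> have integral 0, so the tangent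
    line bound integrates to \<open>G\<close>.\<close>
  have "((\<lambda>u. G * (1 + (\<Sum>z\<in>Z. ln (m u z) - J z))) has_integral G * (1 + (\<Sum>z\<in>Z. J z - J z))) {0<..<1}"
  proof -
    have "((\<lambda>u. ln (m u z) - J z) has_integral J z - J z) {0<..<1}" for z
      unfolding m_def J_def by (intro has_integral_diff has_integral_ln_max one) auto
    then show ?thesis
      using assms by (intro has_integral_mult_right has_integral_add has_integral_sum one) auto
  qed
  from has_integral_le[OF this F_int lower] have "G \<le> (bw_norm n P)\<^sup>2 / real (n + 1)" by simp
  then show ?thesis by (simp add: G_def P_def field_simps)
qed

section \<open>Logarithmic energy in stereographic coordinates\<close>

lemma sphere2_off_north_pole:
  fixes x :: "real^3"
  assumes "x \<in> sphere2" "x \<noteq> north_pole"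
  shows "x$3 < 1" "1 + (cmod (stereo x))\<^sup>2 = 2 / (1 - x$3)"
proof -
  have n: "(x$1)\<^sup>2 + (x$2)\<^sup>2 + (x$3)\<^sup>2 = 1"
    using assms(1) by (simp add: sphere2_def norm_eq_1 inner_vec_def sum_3 power2_eq_square)
  have "x$3 \<noteq> 1"
  proof
    assume "x$3 = 1"
    with n have "x$1 = 0" "x$2 = 0" by (auto simp: sum_power2_eq_zero_iff)
    with \<open>x$3 = 1\<close> have "x = north_pole"
      by (simp add: north_pole_def Finite_Cartesian_Product.vec_eq_iff forall_3)
    with assms show False by simp
  qed
  moreover have "\<bar>x$3\<bar> \<le> 1"
    using n by (simp add: abs_le_square_iff[of _ 1, simplified] ) (smt (verit) zero_le_power2)
  ultimately show lt: "x$3 < 1" by simp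
  have "(cmod (stereo x))\<^sup>2 = ((x$1)\<^sup>2 + (x$2)\<^sup>2) / (1 - x$3)\<^sup>2"
    by (simp add: stereo_def norm_divide power_divide cmod_power2 del: of_real_diff)
  also have "(x$1)\<^sup>2 + (x$2)\<^sup>2 = (1 - x$3) * (1 + x$3)"
    using n by (simp add: power2_eq_square algebra_simps)
  finally have "(cmod (stereo x))\<^sup>2 = (1 + x$3) / (1 - x$3)"
    using lt by (simp add: power2_eq_square)
  then show "1 + (cmod (stereo x))\<^sup>2 = 2 / (1 - x$3)"
    using lt by (simp add: field_simps)
qed

text \<open>The chordal distance formula, squared and cleared of denominators. It gives injectivity
  of \<open>stereo\<close> and, after taking logarithms, the energy of a pair.\<close>

lemma dist_stereo:
  fixes x y :: "real^3"
  assumes "x \<in> sphere2" "x \<noteq> north_pole" "y \<in> sphere2" "y \<noteq> north_pole"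
  shows "(dist x y)\<^sup>2 * ((1 + (cmod (stereo x))\<^sup>2) * (1 + (cmod (stereo y))\<^sup>2))
       = 4 * (cmod (stereo x - stereo y))\<^sup>2"
proof -
  define a b where "a = 1 - x$3" and "b = 1 - y$3"
  have ab: "a > 0" "b > 0" using sphere2_off_north_pole(1) assms by (auto simp: a_def b_def)
  have nx: "(x$1)\<^sup>2 + (x$2)\<^sup>2 = a * (2 - a)"
    using assms(1) by (simp add: sphere2_def norm_eq_1 inner_vec_def sum_3 power2_eq_square a_def algebra_simps)
  have ny: "(y$1)\<^sup>2 + (y$2)\<^sup>2 = b * (2 - b)"
    using assms(3) by (simp add: sphere2_def norm_eq_1 inner_vec_def sum_3 power2_eq_square b_def algebra_simps)
  have "(dist x y)\<^sup>2 = (x$1 - y$1)\<^sup>2 + (x$2 - y$2)\<^sup>2 + (a - b)\<^sup>2"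
    by (simp add: dist_norm power2_norm_eq_inner inner_vec_def sum_3 a_def b_def)
       (simp add: power2_eq_square algebra_simps)
  then have d: "(dist x y)\<^sup>2 = 2 * a + 2 * b - 2 * (x$1 * y$1 + x$2 * y$2) - 2 * a * b"
    using nx ny by (simp add: power2_eq_square algebra_simps)
  have "(cmod (stereo x - stereo y))\<^sup>2 = (x$1 / a - y$1 / b)\<^sup>2 + (x$2 / a - y$2 / b)\<^sup>2"
    by (simp add: stereo_def cmod_power2 a_def b_def complex_eq_iff del: of_real_diff)
  also have "\<dots> = ((x$1)\<^sup>2 + (x$2)\<^sup>2) / a\<^sup>2 + ((y$1)\<^sup>2 + (y$2)\<^sup>2) / b\<^sup>2 - 2 * (x$1 * y$1 + x$2 * y$2) / (a * b)"
    using ab by (simp add: power2_eq_square field_simps)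
  also have "\<dots> = (2 - a) / a + (2 - b) / b - 2 * (x$1 * y$1 + x$2 * y$2) / (a * b)"
    unfolding nx ny using ab by (simp add: power2_eq_square)
  also have "\<dots> = (dist x y)\<^sup>2 / (a * b)"
    unfolding d using ab by (simp add: field_simps)
  finally show ?thesis
    using ab sphere2_off_north_pole(2)[OF assms(1,2)] sphere2_off_north_pole(2)[OF assms(3,4)]
    by (simp add: a_def b_def)
qed

lemma inj_on_stereo: "inj_on stereo (sphere2 - {north_pole})"
proof
  fix x y assume "x \<in> sphere2 - {north_pole}" "y \<in> sphere2 - {north_pole}" "stereo x = stereo y"
  then have "(dist x y)\<^sup>2 * ((1 + (cmod (stereo x))\<^sup>2) * (1 + (cmod (stereo y))\<^sup>2)) = 0"
    using dist_stereo[of x y] by simp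
  moreover have "1 + (cmod (stereo x))\<^sup>2 > 0" "1 + (cmod (stereo y))\<^sup>2 > 0"
    by (auto intro: add_pos_nonneg)
  ultimately show "x = y" by simp
qed

lemma stereo_surj: "stereo ` (sphere2 - {north_pole}) = UNIV"
proof -
  have "\<exists>x \<in> sphere2 - {north_pole}. stereo x = z" for z
  proof -
    define d where "d = 1 + (cmod z)\<^sup>2"
    have d: "d > 0" "d = 1 + (Re z)\<^sup>2 + (Im z)\<^sup>2" by (auto simp: d_def cmod_power2 intro: add_pos_nonneg)
    \<comment> \<open>The inverse stereographic projection of \<open>z\<close>.\<close>
    define x :: "real^3" where "x = vector [2 * Re z / d, 2 * Im z / d, 1 - 2 / d]"
    have x [simp]: "x$1 = 2 * Re z / d" "x$2 = 2 * Im z / d" "x$3 = 1 - 2 / d"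
      by (auto simp: x_def)
    have "x$1 * x$1 + x$2 * x$2 + x$3 * x$3 = (4 * ((Re z)\<^sup>2 + (Im z)\<^sup>2) + (d - 2)\<^sup>2) / d\<^sup>2"
      using d(1) by (simp add: power2_eq_square field_simps)
    also have "4 * ((Re z)\<^sup>2 + (Im z)\<^sup>2) + (d - 2)\<^sup>2 = d\<^sup>2"
      using d(2) by (simp add: power2_eq_square algebra_simps)
    finally have "x \<in> sphere2" using d(1)
      by (simp add: sphere2_def norm_eq_1 inner_vec_def sum_3)
    moreover have "x \<noteq> north_pole"
    proof
      assume "x = north_pole"
      then have "x$3 = 1" by (simp add: north_pole_def)
      then show False using d(1) by simp
    qed
    moreover have "stereo x = z"
      using d(1) by (simp add: stereo_def complex_eq_iff del: of_real_diff)
    ultimately show ?thesis by blast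
  qed
  then show ?thesis by (auto simp: image_iff) metis
qed

lemma ln_dist_stereo:
  assumes "x \<in> sphere2 - {north_pole}" "y \<in> sphere2 - {north_pole}" "x \<noteq> y"
  shows "ln (dist x y) = ln 2 + ln (cmod (stereo x - stereo y))
           - ln (1 + (cmod (stereo x))\<^sup>2) / 2 - ln (1 + (cmod (stereo y))\<^sup>2) / 2"
proof -
  have "stereo x \<noteq> stereo y" using inj_on_stereo assms by (auto dest: inj_onD)
  then have pos: "cmod (stereo x - stereo y) > 0" "dist x y > 0" "1 + (cmod (stereo x))\<^sup>2 > 0"
      "1 + (cmod (stereo y))\<^sup>2 > 0"
    using assms by (auto intro: add_pos_nonneg)
  have "(dist x y)\<^sup>2 * ((1 + (cmod (stereo x))\<^sup>2) * (1 + (cmod (stereo y))\<^sup>2))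
       = (2 * cmod (stereo x - stereo y))\<^sup>2"
    using dist_stereo[of x y] assms by (simp add: power_mult_distrib)
  then have "ln ((dist x y)\<^sup>2 * ((1 + (cmod (stereo x))\<^sup>2) * (1 + (cmod (stereo y))\<^sup>2)))
      = ln ((2 * cmod (stereo x - stereo y))\<^sup>2)" by simp
  then have "2 * ln (dist x y) + ln (1 + (cmod (stereo x))\<^sup>2) + ln (1 + (cmod (stereo y))\<^sup>2)
      = 2 * (ln 2 + ln (cmod (stereo x - stereo y)))"
    using pos
    by (simp only: ln_mult_pos ln_realpow mult_pos_pos zero_less_power zero_less_numeral of_nat_numeral add.assoc)
  moreover have "a = d + e - b / 2 - c / 2" if "2 * a + b + c = 2 * (d + e)" for a b c d e :: real
    using that by simp
  ultimately show ?thesis by blast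
qed

text \<open>Each point lies in \<open>N - 1\<close> ordered pairs as first and in as many as second
  entry, and each time contributes half of \<open>ln (1 + (cmod z)^2)\<close>.\<close>

lemma log_energy_stereo:
  assumes "finite A" "A \<subseteq> sphere2 - {north_pole}" "card A = N"
  shows "log_energy A = - real N * (real N - 1) * ln 2
           - (\<Sum>z\<in>stereo ` A. \<Sum>w\<in>stereo ` A - {z}. ln (cmod (z - w)))
           + (real N - 1) * (\<Sum>z\<in>stereo ` A. ln (1 + (cmod z)\<^sup>2))"
proof -
  define l where "l z = ln (1 + (cmod z)\<^sup>2) / 2" for z
  define Z where "Z = stereo ` A"
  have inj: "inj_on stereo A" using inj_on_subset[OF inj_on_stereo assms(2)] .
  have Z: "finite Z" "card Z = N" using assms inj by (auto simp: Z_def card_image)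
  have "(\<Sum>(x,y)\<in>{(x,y). x \<in> A \<and> y \<in> A \<and> x \<noteq> y}. ln (dist x y))
      = (\<Sum>(x,y)\<in>(SIGMA x:A. A - {x}). ln (dist x y))"
    by (intro sum.cong) auto
  also have "\<dots> = (\<Sum>x\<in>A. \<Sum>y\<in>A - {x}. ln (dist x y))"
    using assms(1) by (subst sum.Sigma) auto
  also have "\<dots> = (\<Sum>x\<in>A. \<Sum>y\<in>A - {x}. ln 2 + ln (cmod (stereo x - stereo y)) - l (stereo x) - l (stereo y))"
    using assms(2) unfolding l_def by (intro sum.cong refl ln_dist_stereo) auto
  also have "\<dots> = (\<Sum>x\<in>A. \<Sum>w\<in>Z - {stereo x}. ln 2 + ln (cmod (stereo x - w)) - l (stereo x) - l w)"
  proof (intro sum.cong refl)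
    fix x assume "x \<in> A"
    have "Z - {stereo x} = stereo ` (A - {x})"
      using inj \<open>x \<in> A\<close> by (auto simp: Z_def inj_on_def)
    then show "(\<Sum>y\<in>A - {x}. ln 2 + ln (cmod (stereo x - stereo y)) - l (stereo x) - l (stereo y))
        = (\<Sum>w\<in>Z - {stereo x}. ln 2 + ln (cmod (stereo x - w)) - l (stereo x) - l w)"
      using inj by (simp add: sum.reindex inj_on_diff)
  qed
  also have "\<dots> = (\<Sum>z\<in>Z. \<Sum>w\<in>Z - {z}. ln 2 + ln (cmod (z - w)) - l z - l w)"
    unfolding Z_def using inj by (simp add: sum.reindex)
  also have "\<dots> = (\<Sum>z\<in>Z. (real N - 1) * ln 2 + (\<Sum>w\<in>Z - {z}. ln (cmod (z - w))) - (real N - 1) * l z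
       - ((\<Sum>w\<in>Z. l w) - l z))"
  proof (intro sum.cong refl)
    fix z assume "z \<in> Z"
    then have "real (card (Z - {z})) = real N - 1"
      using Z by (metis One_nat_def Suc_leI card_Diff_singleton card_gt_0_iff empty_iff of_nat_1 of_nat_diff)
    then show "(\<Sum>w\<in>Z - {z}. ln 2 + ln (cmod (z - w)) - l z - l w)
      = (real N - 1) * ln 2 + (\<Sum>w\<in>Z - {z}. ln (cmod (z - w))) - (real N - 1) * l z - ((\<Sum>w\<in>Z. l w) - l z)"
      using Z(1) \<open>z \<in> Z\<close> by (simp add: sum.distrib sum_subtractf sum_diff1)
  qed
  also have "\<dots> = real N * (real N - 1) * ln 2 + (\<Sum>z\<in>Z. \<Sum>w\<in>Z - {z}. ln (cmod (z - w)))
       - (real N - 1) * (2 * (\<Sum>z\<in>Z. l z))"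
    using Z by (simp add: sum.distrib sum_subtractf flip: sum_distrib_left) (simp add: algebra_simps)
  also have "2 * (\<Sum>z\<in>Z. l z) = (\<Sum>z\<in>Z. ln (1 + (cmod z)\<^sup>2))"
    by (simp add: l_def sum_distrib_left)
  finally show ?thesis by (simp add: log_energy_def Z_def)
qed

lemma log_energy_isometry:
  assumes "\<And>x y. dist (f x) (f y) = dist x y"
  shows "log_energy (f ` A) = log_energy A"
proof -
  have eq: "f x = f y \<longleftrightarrow> x = y" for x y
    using assms[of x y] by (metis dist_eq_0_iff)
  have "inj_on (map_prod f f) {(x,y). x \<in> A \<and> y \<in> A \<and> x \<noteq> y}"
    by (rule inj_onI) (clarsimp simp: eq)
  moreover have "{(x,y). x \<in> f ` A \<and> y \<in> f ` A \<and> x \<noteq> y}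
      = map_prod f f ` {(x,y). x \<in> A \<and> y \<in> A \<and> x \<noteq> y}"
    by (force simp: eq)
  ultimately show ?thesis
    unfolding log_energy_def by (simp add: sum.reindex case_prod_unfold assms)
qed

lemma infinite_sphere2: "infinite sphere2"
proof
  assume "finite sphere2"
  then have "finite (stereo ` (sphere2 - {north_pole}))" by simp
  then show False by (simp add: stereo_surj infinite_UNIV_char_0)
qed

text \<open>An arbitrary configuration may contain the north pole. A finite set misses some point
  \<open>a\<close> of the sphere, and an orthogonal map taking \<open>a\<close> to the pole moves
  the set off the pole.\<close>

lemma rotate_off_north_pole:
  assumes "finite A" "A \<subseteq> sphere2"
  obtains B where "finite B" "B \<subseteq> sphere2 - {north_pole}" "card B = card A" "log_energy B = log_energy A"
proof -
  obtain a where a: "a \<in> sphere2" "a \<notin> A"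
    using infinite_sphere2 assms by (meson ex_new_if_finite finite_subset subsetI)
  have "norm north_pole = 1"
    by (simp add: north_pole_def norm_eq_1 inner_vec_def sum_3)
  then obtain f where f: "orthogonal_transformation f" "f a = north_pole"
    using orthogonal_transformation_exists[of a north_pole] a by (auto simp: sphere2_def)
  have isometry: "dist (f x) (f y) = dist x y" for x y
  proof -
    have "linear f" and norm: "norm (f v) = norm v" for v
      using f(1) by (simp_all add: orthogonal_transformation)
    then show ?thesis by (simp only: dist_norm linear_diff[OF \<open>linear f\<close>, symmetric] norm)
  qed
  have inj: "inj f" by (rule injI) (metis isometry dist_eq_0_iff)
  show thesis
  proof
    show "f ` A \<subseteq> sphere2 - {north_pole}"
    proof
      fix y assume "y \<in> f ` A"
      then obtain x where x: "x \<in> A" "y = f x" by blast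
      then have "y \<in> sphere2"
        using assms(2) f(1) by (auto simp: sphere2_def orthogonal_transformation)
      moreover have "y \<noteq> north_pole"
        using x a(2) f(2) injD[OF inj, of x a] by auto
      ultimately show "y \<in> sphere2 - {north_pole}" by blast
    qed
    show "card (f ` A) = card A" using inj by (simp add: card_image inj_on_subset)
    show "log_energy (f ` A) = log_energy A"
      by (rule log_energy_isometry) (rule isometry)
  qed (use assms in auto)
qed

section \<open>Energy bounds\<close>

text \<open>Stirling's upper bound with constant \<open>e\<close>, which is attained at
  \<open>n = 1\<close>. The induction step amounts to
  \<open>(n + 1/2) * ln ((n + 1) / n) \<ge> 1\<close>.\<close>

lemma ln_fact_le:
  assumes "n \<ge> 1"
  shows "ln (fact n :: real) \<le> 1 + (real n + 1 / 2) * ln (real n) - real n"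
  using assms
proof (induction n rule: dec_induct)
  case base
  then show ?case by simp
next
  case (step n)
  have "2 * (real (Suc n) - real n) / (real n + real (Suc n)) \<le> ln (real (Suc n)) - ln (real n)"
    using step.hyps by (intro ln_inverse_approx_ge) auto
  then have "1 \<le> (real n + 1 / 2) * (ln (real (Suc n)) - ln (real n))"
    by (simp add: field_simps)
  moreover have "ln (fact (Suc n) :: real) = ln (real (Suc n)) + ln (fact n)"
    by (simp add: ln_mult del: of_nat_Suc)
  ultimately show ?case using step.IH by (simp add: algebra_simps)
qed

text \<open>The last entry of the new row has logarithm 0. The others come from the old row by
  \<open>(n + 1 - k) * (n + 1 choose k) = (n + 1) * (n choose k)\<close>, and the factors
  \<open>n + 1 - k\<close> multiply to the factorial.\<close>

lemma sum_ln_binomial_Suc: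
  "(\<Sum>k<Suc (Suc n). ln (real (Suc n choose k)))
   = (\<Sum>k<Suc n. ln (real (n choose k))) + real (Suc n) * ln (real (Suc n)) - ln (fact (Suc n))"
proof -
  have "(\<Sum>k<Suc (Suc n). ln (real (Suc n choose k))) = (\<Sum>k<Suc n. ln (real (Suc n choose k)))"
    by (subst sum.lessThan_Suc) simp
  also have "\<dots> = (\<Sum>k<Suc n. ln (real (n choose k)) + ln (real (Suc n)) - ln (real (Suc n - k)))"
  proof (intro sum.cong refl)
    fix k assume "k \<in> {..<Suc n}"
    then have k: "k \<le> n" by simp
    have "(Suc n - k) * (Suc n choose k) = Suc n * (n choose k)"
      using binomial_absorb_comp[of "Suc n" k] by simp
    then have "real (Suc n - k) * real (Suc n choose k) = real (Suc n) * real (n choose k)"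
      by (metis of_nat_mult)
    moreover have "real (Suc n - k) > 0" "real (Suc n choose k) > 0" "real (n choose k) > 0" "real (Suc n) > 0"
      using k by simp_all
    ultimately have "ln (real (Suc n - k)) + ln (real (Suc n choose k)) = ln (real (Suc n)) + ln (real (n choose k))"
      by (metis ln_mult_pos)
    then show "ln (real (Suc n choose k)) = ln (real (n choose k)) + ln (real (Suc n)) - ln (real (Suc n - k))"
      by linarith
  qed
  also have "\<dots> = (\<Sum>k<Suc n. ln (real (n choose k))) + real (Suc n) * ln (real (Suc n)) - (\<Sum>k<Suc n. ln (real (Suc n - k)))"
    by (simp only: sum.distrib sum_subtractf sum_constant card_lessThan)
  also have "(\<Sum>k<Suc n. ln (real (Suc n - k))) = (\<Sum>k<Suc n. ln (real (Suc k)))"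
    by (rule sum.reindex_bij_witness[of _ "\<lambda>k. n - k" "\<lambda>k. n - k"]) (auto simp: Suc_diff_le)
  also have "\<dots> = ln (\<Prod>k<Suc n. real (Suc k))"
    by (rule ln_prod[symmetric]) auto
  also have "(\<Prod>k<Suc n. real (Suc k)) = fact (Suc n)"
    unfolding fact_prod_Suc by (simp only: of_nat_prod atLeast0LessThan)
  finally show ?thesis .
qed

text \<open>By Stirling, each step of the recursion adds at least
  \<open>n - ln (n + 1) / 2\<close>.\<close>

lemma sum_ln_binomial_ge:
  "(real n)\<^sup>2 / 2 - real n / 2 - real n / 2 * ln (real n + 1) \<le> (\<Sum>k<Suc n. ln (real (n choose k)))"
proof (induction n)
  case 0
  then show ?case by simp
next
  case (Suc n)
  have "ln (fact (Suc n) :: real) \<le> 1 + (real (Suc n) + 1 / 2) * ln (real (Suc n)) - real (Suc n)"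
    by (rule ln_fact_le) simp
  \<comment> \<open>This absorbs the shift of the logarithm's argument in the claimed bound from
    \<open>n + 1\<close> to \<open>n + 2\<close>.\<close>
  moreover have "(real n + 1) * ln (real n + 1) \<le> (real n + 1) * ln (real n + 2)"
    by (intro mult_left_mono) auto
  ultimately show ?case
    unfolding sum_ln_binomial_Suc using Suc by (simp add: power2_eq_square algebra_simps add_divide_distrib)
qed

section \<open>Lower bound for the energy of an arbitrary point set\<close>

lemma sum_off_diagonal_symmetric:
  fixes g :: "nat \<Rightarrow> nat \<Rightarrow> real"
  assumes "\<And>i j. g i j = g j i"
  shows "(\<Sum>i<n. \<Sum>j\<in>{..<n} - {i}. g i j) = 2 * (\<Sum>i<n. \<Sum>j<i. g i j)"
proof (induction n)
  case (Suc n)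
  have "(\<Sum>i<n. \<Sum>j\<in>{..<Suc n} - {i}. g i j) = (\<Sum>i<n. g n i + (\<Sum>j\<in>{..<n} - {i}. g i j))"
  proof (intro sum.cong refl)
    fix i assume "i \<in> {..<n}"
    then have "{..<Suc n} - {i} = insert n ({..<n} - {i})" by auto
    then show "(\<Sum>j\<in>{..<Suc n} - {i}. g i j) = g n i + (\<Sum>j\<in>{..<n} - {i}. g i j)"
      using assms[of i n] by simp
  qed
  moreover have "{..<Suc n} - {n} = {..<n}" by auto
  ultimately show ?case using Suc by (simp add: sum.distrib)
qed simp

text \<open>Take logarithms in \<open>vandermonde_bound\<close>. Its exponent \<open>n\<close> is
  the coefficient of the sum of \<open>ln (1 + (cmod z)^2)\<close> in
  \<open>log_energy_stereo\<close>, so everything depending on the points cancels.\<close>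

lemma log_energy_ge_sum_ln_binomial:
  assumes "A \<subseteq> sphere2" "card A = Suc n"
  shows "(\<Sum>k<Suc n. ln (real (n choose k))) - real (Suc n) * real n * ln 2 \<le> log_energy A"
proof -
  have "finite A" using assms(2) by (metis card.infinite nat.distinct(1))
  then obtain B where B: "finite B" "B \<subseteq> sphere2 - {north_pole}" "card B = Suc n" "log_energy B = log_energy A"
    using rotate_off_north_pole assms by metis
  define Z where "Z = stereo ` B"
  have "inj_on stereo B" using inj_on_subset[OF inj_on_stereo B(2)] .
  then have Z: "finite Z" "card Z = Suc n" using B by (auto simp: Z_def card_image)
  then obtain z where z: "bij_betw z {..<Suc n} Z"
    using ex_bij_betw_nat_finite[of Z] by (auto simp: atLeast0LessThan)
  then have inj: "inj_on z {..<Suc n}" and img: "z ` {..<Suc n} = Z" by (auto simp: bij_betw_def)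
  have neq: "z i \<noteq> z j" if "j < i" "i < Suc n" for i j
    using that inj_onD[OF inj, of i j] by auto
  define S where "S = (\<Sum>i<Suc n. \<Sum>j<i. ln (cmod (z i - z j)))"
  have "(\<Sum>w\<in>Z. \<Sum>v\<in>Z - {w}. ln (cmod (w - v))) = (\<Sum>i<Suc n. \<Sum>v\<in>Z - {z i}. ln (cmod (z i - v)))"
    unfolding img[symmetric] by (rule sum.reindex_cong[OF inj]) auto
  also have "\<dots> = (\<Sum>i<Suc n. \<Sum>j\<in>{..<Suc n} - {i}. ln (cmod (z i - z j)))"
  proof (intro sum.cong refl)
    fix i assume "i \<in> {..<Suc n}"
    then have "Z - {z i} = z ` ({..<Suc n} - {i})"
      using inj img by (auto simp: inj_on_def)
    then show "(\<Sum>v\<in>Z - {z i}. ln (cmod (z i - v))) = (\<Sum>j\<in>{..<Suc n} - {i}. ln (cmod (z i - z j)))"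
      by (intro sum.reindex_cong[OF inj_on_diff[OF inj]]) auto
  qed
  also have "\<dots> = 2 * S"
    unfolding S_def by (rule sum_off_diagonal_symmetric) (simp add: norm_minus_commute)
  finally have pairs: "(\<Sum>w\<in>Z. \<Sum>v\<in>Z - {w}. ln (cmod (w - v))) = 2 * S" .
  define V where "V = (\<Prod>i<Suc n. \<Prod>j<i. cmod (z i - z j))"
  have V: "V > 0" unfolding V_def using neq by (intro prod_pos) auto
  have lnV: "ln V = S"
  proof -
    have "ln V = (\<Sum>i<Suc n. ln (\<Prod>j<i. cmod (z i - z j)))"
      unfolding V_def by (rule ln_prod) (use neq in \<open>auto intro!: prod_pos\<close>)
    also have "\<dots> = S"
      unfolding S_def by (intro sum.cong refl ln_prod) (use neq in auto)
    finally show ?thesis .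
  qed
  have bin: "(\<Prod>k<Suc n. real (n choose k)) > 0" by (intro prod_pos) auto
  have pos: "1 + (cmod w)\<^sup>2 > 0" for w by (intro add_pos_nonneg) auto
  have "ln ((\<Prod>k<Suc n. real (n choose k)) * V\<^sup>2) \<le> ln (\<Prod>i<Suc n. (1 + (cmod (z i))\<^sup>2) ^ n)"
    using vandermonde_bound[of n z] V bin pos unfolding V_def[symmetric]
    by (subst ln_le_cancel_iff) (auto intro!: prod_pos simp del: prod.lessThan_Suc)
  moreover have "ln ((\<Prod>k<Suc n. real (n choose k)) * V\<^sup>2) = (\<Sum>k<Suc n. ln (real (n choose k))) + 2 * S"
  proof (subst ln_mult_pos)
    have "ln (\<Prod>k<Suc n. real (n choose k)) = (\<Sum>k<Suc n. ln (real (n choose k)))"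
      by (rule ln_prod) auto
    then show "ln (\<Prod>k<Suc n. real (n choose k)) + ln (V\<^sup>2) = (\<Sum>k<Suc n. ln (real (n choose k))) + 2 * S"
      using V by (simp only: ln_realpow lnV of_nat_numeral)
  qed (use V bin in auto)
  moreover have "ln (\<Prod>i<Suc n. (1 + (cmod (z i))\<^sup>2) ^ n) = (\<Sum>i<Suc n. real n * ln (1 + (cmod (z i))\<^sup>2))"
    using pos by (subst ln_prod)
      (auto simp: ln_realpow less_imp_neq[OF pos, symmetric] simp del: sum.lessThan_Suc)
  moreover have "(\<Sum>i<Suc n. real n * ln (1 + (cmod (z i))\<^sup>2)) = real n * (\<Sum>w\<in>Z. ln (1 + (cmod w)\<^sup>2))"
    unfolding img[symmetric] sum_distrib_left by (rule sum.reindex_cong[OF inj, symmetric]) auto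
  moreover have "log_energy A = - real (Suc n) * real n * ln 2 - 2 * S + real n * (\<Sum>w\<in>Z. ln (1 + (cmod w)\<^sup>2))"
    using log_energy_stereo[OF B(1,2,3)] B(4) pairs unfolding Z_def[symmetric] by simp
  ultimately show ?thesis by linarith
qed

section \<open>Upper bound for the energy of the root points\<close>

lemma poly_pderiv_prod_root:
  fixes z :: complex
  assumes "finite Z" "z \<in> Z"
  shows "poly (pderiv (\<Prod>w\<in>Z. [:- w, 1:])) z = (\<Prod>w\<in>Z - {z}. z - w)"
proof -
  have "(\<Prod>w\<in>Z. [:- w, 1:]) = [:- z, 1:] * (\<Prod>w\<in>Z - {z}. [:- w, 1:])"
    using assms by (rule prod.remove)
  then have "poly (pderiv (\<Prod>w\<in>Z. [:- w, 1:])) z = poly (\<Prod>w\<in>Z - {z}. [:- w, 1:]) z"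
    by (simp only: pderiv_mult poly_add poly_mult) (simp add: pderiv_pCons)
  then show ?thesis by (simp add: poly_prod)
qed

text \<open>Summing the logarithm of the condition number bound over the roots gives
  \<open>T \<ge> N * ln b + (N/2 - 1) * S - N * ln C\<close>. In the energy this leaves
  \<open>S\<close> with coefficient \<open>N - 1 - (N/2 - 1) = N/2\<close>, which the bound
  \<open>2 * ln b \<ge> S - N + ln (N + 1)\<close> cancels.\<close>

lemma log_energy_root_points_le:
  fixes p :: "complex poly"
  assumes "C > 0" "lead_coeff p = 1" "degree p = N" "N > 0" "mu_norm N p \<le> ereal (C * sqrt (real N))"
  shows "log_energy (root_points p) \<le> - real N * (real N - 1) * ln 2 + real N * ln C
           - real N / 2 * (ln (real N + 1) - real N)"
proof -
  define Z where "Z = {z. poly p z = 0}"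
  have "p \<noteq> 0" using assms by auto
  then have fin: "finite Z" unfolding Z_def by (rule poly_roots_finite)
  have at: "mu_norm_at N p z \<le> ereal (C * sqrt (real N))" if "z \<in> Z" for z
    using assms(5) that unfolding mu_norm_def Z_def by (meson SUP_upper order_trans)
  \<comment> \<open>A multiple root would have infinite condition number. Hence the roots are simple
    and there are \<open>N\<close> of them.\<close>
  have simple: "poly (pderiv p) z \<noteq> 0" if "z \<in> Z" for z
    using at[OF that] by (auto simp: mu_norm_at_def)
  then have "rsquarefree p" by (auto simp: rsquarefree_roots Z_def)
  from complex_poly_decompose_rsquarefree[OF this] have p: "p = (\<Prod>z\<in>Z. [:- z, 1:])"
    using assms(2) by (simp add: Z_def)
  have card: "card Z = N"
    using assms(3) unfolding p by (subst (asm) degree_prod_sum_eq) auto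
  have root_points: "root_points p \<subseteq> sphere2 - {north_pole}" "stereo ` root_points p = Z"
  proof -
    show "root_points p \<subseteq> sphere2 - {north_pole}" by (auto simp: root_points_def)
    show "stereo ` root_points p = Z"
    proof
      show "Z \<subseteq> stereo ` root_points p"
      proof
        fix z assume "z \<in> Z"
        moreover obtain x where "x \<in> sphere2 - {north_pole}" "z = stereo x"
          using stereo_surj by (metis UNIV_I imageE)
        ultimately show "z \<in> stereo ` root_points p" by (auto simp: root_points_def Z_def)
      qed
    qed (auto simp: root_points_def Z_def)
  qed
  have inj: "inj_on stereo (root_points p)" using inj_on_subset[OF inj_on_stereo root_points(1)] .
  have fin_rp: "finite (root_points p)" "card (root_points p) = N"
    using fin card inj root_points(2) by (metis finite_imageD, metis card_image)
  define b where "b = bw_norm N p"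
  define S where "S = (\<Sum>z\<in>Z. ln (1 + (cmod z)\<^sup>2))"
  have b_ge: "exp (S - real N) * real (N + 1) \<le> b\<^sup>2"
    using bw_norm_ge[OF fin] unfolding b_def S_def card by (simp flip: p)
  have "b \<ge> 0" by (simp add: b_def bw_norm_def sum_nonneg)
  moreover have "b \<noteq> 0"
  proof
    assume "b = 0"
    then have "exp (S - real N) * real (N + 1) \<le> 0" using b_ge by simp
    then show False by (simp add: mult_le_0_iff)
  qed
  ultimately have b: "b > 0" by simp
  have "ln (exp (S - real N) * real (N + 1)) \<le> ln (b\<^sup>2)"
    using b_ge b by (subst ln_le_cancel_iff) auto
  then have ln_b: "S - real N + ln (real N + 1) \<le> 2 * ln b"
    using b by (simp add: ln_mult ln_realpow add.commute)
  have each: "ln b + (real N / 2 - 1) * ln (1 + (cmod z)\<^sup>2) \<le> ln C + (\<Sum>w\<in>Z - {z}. ln (cmod (z - w)))"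
    if "z \<in> Z" for z
  proof -
    have d: "poly (pderiv p) z = (\<Prod>w\<in>Z - {z}. z - w)"
      using poly_pderiv_prod_root[OF fin that] by (simp flip: p)
    have pos: "1 + (cmod z)\<^sup>2 > 0" by (intro add_pos_nonneg) auto
    have dpos: "cmod (poly (pderiv p) z) > 0" using simple[OF that] by simp
    have "sqrt (real N) * b * (1 + (cmod z)\<^sup>2) powr (real N / 2 - 1) / cmod (poly (pderiv p) z) \<le> C * sqrt (real N)"
      using at[OF that] simple[OF that] by (simp add: mu_norm_at_def b_def)
    \<comment> \<open>The factor \<open>sqrt N\<close> in the definition of the condition number
      cancels against the one in the hypothesis, which leaves just \<open>C\<close>.\<close>
    then have "sqrt (real N) * (b * (1 + (cmod z)\<^sup>2) powr (real N / 2 - 1)) \<le> sqrt (real N) * (C * cmod (poly (pderiv p) z))"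
      using dpos by (simp add: pos_divide_le_eq mult_ac)
    then have "b * (1 + (cmod z)\<^sup>2) powr (real N / 2 - 1) \<le> C * cmod (poly (pderiv p) z)"
      using assms(4) by simp
    then have "ln (b * (1 + (cmod z)\<^sup>2) powr (real N / 2 - 1)) \<le> ln (C * cmod (poly (pderiv p) z))"
      using b pos dpos assms(1) by (subst ln_le_cancel_iff) auto
    moreover have "ln (b * (1 + (cmod z)\<^sup>2) powr (real N / 2 - 1)) = ln b + (real N / 2 - 1) * ln (1 + (cmod z)\<^sup>2)"
      using b pos by (subst ln_mult_pos) (auto simp: ln_powr)
    moreover have "ln (C * cmod (poly (pderiv p) z)) = ln C + ln (cmod (poly (pderiv p) z))"
      using assms(1) dpos by (rule ln_mult_pos)
    moreover have "ln (cmod (poly (pderiv p) z)) = (\<Sum>w\<in>Z - {z}. ln (cmod (z - w)))"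
      unfolding d prod_norm[symmetric] using fin by (subst ln_prod) auto
    ultimately show ?thesis by simp
  qed
  define T where "T = (\<Sum>z\<in>Z. \<Sum>w\<in>Z - {z}. ln (cmod (z - w)))"
  have "(\<Sum>z\<in>Z. ln b + (real N / 2 - 1) * ln (1 + (cmod z)\<^sup>2)) \<le> (\<Sum>z\<in>Z. ln C + (\<Sum>w\<in>Z - {z}. ln (cmod (z - w))))"
    by (intro sum_mono each)
  then have "real N * ln b + (real N / 2 - 1) * S \<le> real N * ln C + T"
    by (simp add: sum.distrib card S_def T_def flip: sum_distrib_left)
  moreover have "real N * (S - real N + ln (real N + 1)) \<le> real N * (2 * ln b)"
    using ln_b by (intro mult_left_mono) auto
  moreover have "log_energy (root_points p) = - real N * (real N - 1) * ln 2 - T + (real N - 1) * S"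
    using log_energy_stereo[OF fin_rp(1) root_points(1) fin_rp(2)] unfolding root_points(2) T_def S_def .
  ultimately show ?thesis by (simp add: algebra_simps)
qed

theorem theorem1p1:
  fixes C :: real
  assumes "C > 0"
  shows "\<exists>c::real. \<forall>p :: nat \<Rightarrow> complex poly.
           (\<forall>N. lead_coeff (p N) = 1 \<and> degree (p N) = N \<and>
                mu_norm N (p N) \<le> ereal (C * sqrt (real N))) \<longrightarrow>
           (\<forall>N. \<forall>\<mu>. \<mu> \<subseteq> sphere2 \<and> finite \<mu> \<and> card \<mu> = N \<longrightarrow>
                log_energy (root_points (p N)) \<le> log_energy \<mu> + c * real N)"
\<comment> \<open>With \<open>N = n + 1\<close>, the non-logarithmic terms of the two bounds differ
  by \<open>(N^2 - n^2) / 2 + n / 2 = 3 * n / 2 + 1 / 2\<close>, at most \<open>3 / 2 * N\<close>.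
  The condition number adds \<open>N * ln C\<close>, and the remaining logarithms compare in the
  favourable direction.\<close>
proof (intro exI[of _ "ln C + 3 / 2"] allI impI)
  fix p :: "nat \<Rightarrow> complex poly" and N and \<mu> :: "(real^3) set"
  assume p: "\<forall>N. lead_coeff (p N) = 1 \<and> degree (p N) = N \<and> mu_norm N (p N) \<le> ereal (C * sqrt (real N))"
    and \<mu>: "\<mu> \<subseteq> sphere2 \<and> finite \<mu> \<and> card \<mu> = N"
  show "log_energy (root_points (p N)) \<le> log_energy \<mu> + (ln C + 3 / 2) * real N"
  proof (cases N)
    case 0
    \<comment> \<open>The monic constant polynomial has no roots, so both sets are empty and both
      energies 0.\<close>
    have "lead_coeff (p 0) = 1" "degree (p 0) = 0" using p by blast+
    then have "p 0 = 1" by (auto simp: one_pCons elim!: degree_eq_zeroE)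
    moreover have "\<mu> = {}" using 0 \<mu> card_0_eq by blast
    ultimately show ?thesis using 0 by (simp add: root_points_def log_energy_def)
  next
    case (Suc n)
    have N: "real N = real n + 1" using Suc by simp
    have "log_energy (root_points (p N)) \<le> - real N * (real N - 1) * ln 2 + real N * ln C
           - real N / 2 * (ln (real N + 1) - real N)"
    proof (rule log_energy_root_points_le[OF assms])
      show "lead_coeff (p N) = 1" "degree (p N) = N" "mu_norm N (p N) \<le> ereal (C * sqrt (real N))"
        using p by blast+
    qed (use Suc in simp)
    moreover have "(\<Sum>k<Suc n. ln (real (n choose k))) - real N * real n * ln 2 \<le> log_energy \<mu>"
      using log_energy_ge_sum_ln_binomial[of \<mu> n] \<mu> Suc by simp
    moreover have "(real n)\<^sup>2 / 2 - real n / 2 - real n / 2 * ln (real n + 1) \<le> (\<Sum>k<Suc n. ln (real (n choose k)))"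
      by (rule sum_ln_binomial_ge)
    moreover have "real n / 2 * ln (real n + 1) \<le> real N / 2 * ln (real N + 1)"
      using N by (intro mult_mono) auto
    ultimately show ?thesis
      unfolding N by (simp add: power2_eq_square algebra_simps add_divide_distrib)
  qed
qed

end
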